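(* Let $X$ be a complex Banach space, let $T\in\mathcal{B}(X)$, and let $Y\in\mathcal{B}(X)$ be a solution of $TY^2-Y+I=0$ such that $0\in\rho(Y)$. (i) If $\lambda\in\mathbb{C}\setminus\{0\}$ is such that $\frac{\lambda-1}{\lambda^2}\in\rho(T)$, then $\lambda\in\rho(Y)$ and $$(\lambda-Y)^{-1}=\frac{1}{\lambda}+\frac{1}{\lambda^3}\left(\frac{\lambda-1}{\lambda^2}-T\right)^{-1}+\frac{Y}{\lambda^2}-\frac{(\lambda-1)Y}{\lambda^4}\left(\frac{\lambda-1}{\lambda^2}-T\right)^{-1}.$$ (ii) If $\lambda\in\rho(Y)$, $\lambda\neq 0,1$, is such that $\frac{\lambda}{\lambda-1}\in\rho(Y)$, then $\frac{\lambda-1}{\lambda^2}\in\rho(T)$ and $$\left(\frac{\lambda-1}{\lambda^2}-T\right)^{-1}=\frac{\lambda^4}{\lambda-1}\left(\frac{\lambda}{\lambda-1}-Y\right)^{-1}\left((\lambda-Y)^{-1}-\frac{\lambda+Y}{\lambda^2}\right).$$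
   Context: $\mathcal{B}(X)$ is the algebra of bounded linear operators on $X$ with identity $I$; a scalar $\mu$ in an operator expression stands for $\mu I$. For $S\in\mathcal{B}(X)$, $\rho(S)$ is the set of $\mu\in\mathbb{C}$ such that $\mu-S$ is invertible in $\mathcal{B}(X)$. *)

theory Defs
  imports Complex_Main
begin

class complex_vector = ab_group_add +
  fixes scaleC :: "complex \<Rightarrow> 'a \<Rightarrow> 'a" (infixr "*\<^sub>C" 75)
  assumes scaleC_add_right: "a *\<^sub>C (x + y) = a *\<^sub>C x + a *\<^sub>C y"
    and scaleC_add_left: "(a + b) *\<^sub>C x = a *\<^sub>C x + b *\<^sub>C x"
    and scaleC_scaleC: "a *\<^sub>C (b *\<^sub>C x) = (a * b) *\<^sub>C x"
    and scaleC_one: "1 *\<^sub>C x = x"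

text \<open>The real structure that \<open>real_normed_vector\<close> carries is the restriction of the
  complex one.\<close>

class complex_normed_vector = complex_vector + real_normed_vector +
  assumes scaleR_scaleC: "scaleR r x = complex_of_real r *\<^sub>C x"
    and norm_scaleC: "norm (a *\<^sub>C x) = cmod a * norm x"

class complex_banach = complex_normed_vector + complete_space

subclass (in complex_banach) banach ..

definition bounded_clinear :: "('a::complex_normed_vector \<Rightarrow> 'b::complex_normed_vector) \<Rightarrow> bool"
  where "bounded_clinear f \<longleftrightarrow> bounded_linear f \<and> (\<forall>a x. f (a *\<^sub>C x) = a *\<^sub>C f x)"

typedef (overloaded) 'a bop = "{f :: 'a::complex_normed_vector \<Rightarrow> 'a. bounded_clinear f}"
  morphisms bop_apply Bop
  by (rule exI[of _ "\<lambda>x. x"]) (simp add: bounded_clinear_def)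

setup_lifting type_definition_bop

lemma scaleC_zero_right [simp]: "a *\<^sub>C (0::'a::complex_vector) = 0"
  using scaleC_add_right[of a 0 0] by simp

lemma scaleC_minus_right [simp]: "a *\<^sub>C (- (x::'a::complex_vector)) = - (a *\<^sub>C x)"
  using scaleC_add_right[of a x "- x"] by (simp add: eq_neg_iff_add_eq_0 add.commute)

lemma scaleC_diff_right: "a *\<^sub>C ((x::'a::complex_vector) - y) = a *\<^sub>C x - a *\<^sub>C y"
  using scaleC_add_right[of a x "- y"] by simp

lemma bounded_linear_scaleC: "bounded_linear (\<lambda>x::'a::complex_normed_vector. a *\<^sub>C x)"
  by (rule bounded_linear_intro[where K = "cmod a"])
    (simp_all add: scaleC_add_right scaleR_scaleC scaleC_scaleC norm_scaleC mult.commute)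

text \<open>Multiplication is composition and \<open>1\<close> is the identity operator.  The space may be zero, in
  which case \<open>0 = 1\<close>, so there is no instance of \<open>ring_1\<close>.\<close>

instantiation bop :: (complex_normed_vector) "{ring, monoid_mult, complex_vector}"
begin

lift_definition zero_bop :: "'a bop" is "\<lambda>_. 0"
  by (simp add: bounded_clinear_def)

lift_definition one_bop :: "'a bop" is "\<lambda>x. x"
  by (simp add: bounded_clinear_def)

lift_definition plus_bop :: "'a bop \<Rightarrow> 'a bop \<Rightarrow> 'a bop" is "\<lambda>f g x. f x + g x"
  by (simp add: bounded_clinear_def bounded_linear_add scaleC_add_right)

lift_definition minus_bop :: "'a bop \<Rightarrow> 'a bop \<Rightarrow> 'a bop" is "\<lambda>f g x. f x - g x"
  by (simp add: bounded_clinear_def bounded_linear_sub scaleC_diff_right)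

lift_definition uminus_bop :: "'a bop \<Rightarrow> 'a bop" is "\<lambda>f x. - f x"
  by (simp add: bounded_clinear_def bounded_linear_minus)

lift_definition times_bop :: "'a bop \<Rightarrow> 'a bop \<Rightarrow> 'a bop" is "\<lambda>f g x. f (g x)"
  by (simp add: bounded_clinear_def bounded_linear_compose)

lift_definition scaleC_bop :: "complex \<Rightarrow> 'a bop \<Rightarrow> 'a bop" is "\<lambda>a f x. a *\<^sub>C f x"
  by (auto simp: bounded_clinear_def scaleC_scaleC mult.commute
      intro: bounded_linear_compose[OF bounded_linear_scaleC])

instance
proof
  fix A B C :: "'a bop" and a b :: complex
  show "A + B + C = A + (B + C)" by transfer (simp add: add.assoc)
  show "A + B = B + A" by transfer (simp add: add.commute)
  show "0 + A = A" by transfer simp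
  show "- A + A = 0" by transfer simp
  show "A - B = A + - B" by transfer simp
  show "A * B * C = A * (B * C)" by transfer simp
  show "1 * A = A" by transfer simp
  show "A * 1 = A" by transfer simp
  show "(A + B) * C = A * C + B * C" by transfer simp
  show "A * (B + C) = A * B + A * C"
    by transfer (auto simp: bounded_clinear_def linear_add[OF bounded_linear.linear])
  show "a *\<^sub>C (A + B) = a *\<^sub>C A + a *\<^sub>C B" by transfer (simp add: scaleC_add_right)
  show "(a + b) *\<^sub>C A = a *\<^sub>C A + b *\<^sub>C A" by transfer (simp add: scaleC_add_left)
  show "a *\<^sub>C (b *\<^sub>C A) = (a * b) *\<^sub>C A" by transfer (simp add: scaleC_scaleC)
  show "1 *\<^sub>C A = A" by transfer (simp add: scaleC_one)
qed

end

abbreviation scalar_op :: "complex \<Rightarrow> 'a::complex_normed_vector bop"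
  where "scalar_op \<mu> \<equiv> \<mu> *\<^sub>C 1"

definition op_invertible :: "'a::complex_normed_vector bop \<Rightarrow> bool"
  where "op_invertible A \<longleftrightarrow> (\<exists>B. A * B = 1 \<and> B * A = 1)"

text \<open>Meaningful only for invertible \<open>A\<close>; the inverse is then unique.\<close>

definition op_inverse :: "'a::complex_normed_vector bop \<Rightarrow> 'a bop"
  where "op_inverse A = (THE B. A * B = 1 \<and> B * A = 1)"

definition resolvent_set :: "'a::complex_normed_vector bop \<Rightarrow> complex set"
  where "resolvent_set S = {\<mu>. op_invertible (scalar_op \<mu> - S)}"

lemma op_inverse_eqI:
  assumes "A * B = 1" "B * A = 1"
  shows "op_inverse A = B"
  unfolding op_inverse_def
proof (rule the_equality)
  fix C assume "A * C = 1 \<and> C * A = 1"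
  then have "C = C * (A * B)" "C * A * B = B" using assms by simp_all
  then show "C = B" by (simp add: mult.assoc)
qed (use assms in simp)

end

theory Submission
  imports Defs
begin

text \<open>Since \<open>Y\<close> is invertible, \<open>T = Y\<^sup>-\<^sup>1 - Y\<^sup>-\<^sup>2\<close> commutes with \<open>Y\<close>, and
  \<open>\<mu>\<^sup>2 ((\<mu> - 1)/\<mu>\<^sup>2 - T) Y\<^sup>2 = (\<mu> - Y) (\<mu> - (\<mu> - 1) Y)\<close>.  Together with
  \<open>(\<mu> - Y) (\<mu> + Y) = \<mu>\<^sup>2 - Y\<^sup>2\<close>, this factorization gives both resolvent formulas.\<close>

lemma scaleC_zero_left [simp]: "0 *\<^sub>C (x::'a::complex_vector) = 0"
  using scaleC_add_left[of 0 0 x] by simp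

lemma scaleC_minus_left: "(- a) *\<^sub>C (x::'a::complex_vector) = - (a *\<^sub>C x)"
  using scaleC_add_left[of a "- a" x] by (simp add: eq_neg_iff_add_eq_0 add.commute)

lemma scaleC_diff_left: "(a - b) *\<^sub>C (x::'a::complex_vector) = a *\<^sub>C x - b *\<^sub>C x"
  using scaleC_add_left[of a "- b" x] by (simp add: scaleC_minus_left)

lemma scaleC_times_left [simp]:
  "(a *\<^sub>C A) * B = a *\<^sub>C (A * B)" for A B :: "'a::complex_normed_vector bop"
  by transfer simp

lemma scaleC_times_right [simp]:
  "A * (a *\<^sub>C B) = a *\<^sub>C (A * B)" for A B :: "'a::complex_normed_vector bop"
  by transfer (simp add: bounded_clinear_def)

lemma op_inverse_inverse:
  assumes "op_invertible A"
  shows "A * op_inverse A = 1" "op_inverse A * A = 1"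
  using assms op_inverse_eqI unfolding op_invertible_def by metis+

text \<open>Insert \<open>A * B = 1\<close> on the right of \<open>B * C\<close>, swap
  \<open>C * A\<close> to \<open>A * C\<close>, and cancel \<open>B * A = 1\<close>.\<close>

lemma commute_inverse:
  fixes A B C :: "'a::monoid_mult"
  assumes "A * B = 1" "B * A = 1" "A * C = C * A"
  shows "B * C = C * B"
proof -
  have "B * C = B * (C * A) * B" using assms(1) by (simp add: mult.assoc)
  also have "\<dots> = C * B" using assms by (simp add: mult.assoc[symmetric] flip: assms(3))
  finally show ?thesis .
qed

text \<open>\<open>T * Y\<close> and \<open>Y * T\<close> agree after right multiplication by
  \<open>Y * Y\<close>: both products equal \<open>Y * Y - Y\<close>, as \<open>Y - 1\<close>
  commutes with \<open>Y\<close>. An inverse of \<open>Y\<close> lets \<open>Y * Y\<close> be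
  cancelled.\<close>

lemma solution_commutes:
  fixes T Y :: "'a::complex_normed_vector bop"
  assumes "T * (Y * Y) = Y - 1" and inv: "op_invertible Y"
  shows "T * Y = Y * T"
proof -
  obtain Z where Z: "Y * Z = 1" using inv by (auto simp: op_invertible_def)
  have YYZZ: "Y * Y * (Z * Z) = 1" using Z by (simp add: mult.assoc) (simp add: mult.assoc[symmetric])
  have "T * Y * (Y * Y) = T * (Y * Y) * Y" by (simp add: mult.assoc)
  also have "\<dots> = Y * (T * (Y * Y))" by (simp add: assms(1) algebra_simps)
  finally have "T * Y * (Y * Y) * (Z * Z) = Y * T * (Y * Y) * (Z * Z)" by (simp add: mult.assoc)
  then show ?thesis by (metis YYZZ mult.assoc mult.right_neutral)
qed

text \<open>Both sides expand to
  \<open>\<mu>\<^sup>2 - \<mu>\<^sup>2 Y + (\<mu> - 1) Y\<^sup>2\<close>; on the right,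
  \<open>T\<close> disappears because \<open>T * (Y * Y)\<close> is replaced by
  \<open>Y - 1\<close>.\<close>

lemma solution_factorization:
  fixes T Y :: "'a::complex_normed_vector bop"
  assumes "T * (Y * Y) = Y - 1" and "\<mu> \<noteq> 0"
  shows "(scalar_op \<mu> - Y) * (scalar_op \<mu> - (\<mu> - 1) *\<^sub>C Y)
    = \<mu>\<^sup>2 *\<^sub>C ((scalar_op ((\<mu> - 1) / \<mu>\<^sup>2) - T) * (Y * Y))"
proof -
  have "\<mu>\<^sup>2 *\<^sub>C ((scalar_op ((\<mu> - 1) / \<mu>\<^sup>2) - T) * (Y * Y))
    = (\<mu> - 1) *\<^sub>C (Y * Y) - \<mu>\<^sup>2 *\<^sub>C (Y - 1)"
    using assms by (simp add: left_diff_distrib scaleC_diff_right scaleC_scaleC)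
  then show ?thesis
    by (simp add: algebra_simps scaleC_diff_right scaleC_diff_left scaleC_add_right
        scaleC_add_left scaleC_scaleC power2_eq_square scaleC_one)
qed

text \<open>Multiplying the regrouped \<open>B\<close> by \<open>\<mu> - Y\<close> turns its two
  summands into \<open>1 - Y\<^sup>2 / \<mu>\<^sup>2\<close> and
  \<open>Y\<^sup>2 / \<mu>\<^sup>2\<close>, the second by the factorization.\<close>

lemma resolvent_of_solution:
  fixes T Y :: "'a::complex_normed_vector bop"
  assumes TY: "T * (Y * Y) = Y - 1" and inv: "op_invertible Y" and "\<mu> \<noteq> 0"
    and \<nu>: "op_invertible (scalar_op ((\<mu> - 1) / \<mu>\<^sup>2) - T)"
  defines "R \<equiv> op_inverse (scalar_op ((\<mu> - 1) / \<mu>\<^sup>2) - T)"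
  defines "B \<equiv> scalar_op (1 / \<mu>) + (1 / \<mu> ^ 3) *\<^sub>C R + (1 / \<mu>\<^sup>2) *\<^sub>C Y
    - ((\<mu> - 1) / \<mu> ^ 4) *\<^sub>C (Y * R)"
  shows "(scalar_op \<mu> - Y) * B = 1" "B * (scalar_op \<mu> - Y) = 1"
proof -
  let ?N = "scalar_op ((\<mu> - 1) / \<mu>\<^sup>2) - T" and ?A = "scalar_op \<mu> - Y"
  have R: "?N * R = 1" "R * ?N = 1" using op_inverse_inverse[OF \<nu>] by (simp_all add: R_def)
  have "?N * Y = Y * ?N"
    using solution_commutes[OF TY inv] by (simp add: algebra_simps)
  \<comment> \<open>Since \<open>R\<close> commutes with \<open>Y\<close>, it can be moved past
    \<open>Y * Y\<close> to cancel \<open>?N\<close>.\<close>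
  with R have RY: "R * Y = Y * R" by (rule commute_inverse)
  then have "Y * Y * R = R * (Y * Y)" by (metis mult.assoc)
  then have "?N * (Y * Y) * R = ?N * R * (Y * Y)" by (simp only: mult.assoc)
  with R(1) have NYR: "?N * (Y * Y) * R = Y * Y" by simp
  \<comment> \<open>The four terms are paired so that each group contains a factor that multiplies
    well with \<open>?A\<close>: \<open>\<mu> + Y\<close> for the difference of squares, and the
    second factor of the factorization for the terms with \<open>R\<close>.\<close>
  have B: "B = (1 / \<mu>\<^sup>2) *\<^sub>C (scalar_op \<mu> + Y)
      + (1 / \<mu> ^ 4) *\<^sub>C ((scalar_op \<mu> - (\<mu> - 1) *\<^sub>C Y) * R)"
    using \<open>\<mu> \<noteq> 0\<close> by (simp add: B_def left_diff_distrib scaleC_add_right scaleC_diff_right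
      scaleC_scaleC power2_eq_square power3_eq_cube power4_eq_xxxx)
  have "?A * B = (1 / \<mu>\<^sup>2) *\<^sub>C (?A * (scalar_op \<mu> + Y))
      + (1 / \<mu> ^ 4) *\<^sub>C (?A * (scalar_op \<mu> - (\<mu> - 1) *\<^sub>C Y) * R)"
    unfolding B by (simp add: distrib_left mult.assoc)
  also have "\<dots> = (1 / \<mu>\<^sup>2) *\<^sub>C (\<mu>\<^sup>2 *\<^sub>C 1 - Y * Y) + (1 / \<mu>\<^sup>2) *\<^sub>C (Y * Y)"
  proof -
    have "?A * (scalar_op \<mu> + Y) = \<mu>\<^sup>2 *\<^sub>C 1 - Y * Y"
      by (simp add: algebra_simps scaleC_diff_right scaleC_scaleC power2_eq_square)
    moreover have "?A * (scalar_op \<mu> - (\<mu> - 1) *\<^sub>C Y) * R = \<mu>\<^sup>2 *\<^sub>C (Y * Y)"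
      by (simp only: solution_factorization[OF TY \<open>\<mu> \<noteq> 0\<close>] scaleC_times_left NYR)
    ultimately show ?thesis
      using \<open>\<mu> \<noteq> 0\<close> by (simp add: scaleC_scaleC power2_eq_square power4_eq_xxxx)
  qed
  also have "\<dots> = 1"
    using \<open>\<mu> \<noteq> 0\<close> by (simp add: scaleC_diff_right scaleC_scaleC scaleC_one)
  finally show AB: "?A * B = 1" .
  \<comment> \<open>\<open>B\<close> is built from scalars, \<open>Y\<close> and \<open>R\<close>,
    all commuting with \<open>Y\<close>, so the right inverse is also a left inverse.\<close>
  have "Y * B = B * Y"
    unfolding B_def by (simp add: distrib_left distrib_right left_diff_distrib right_diff_distrib RY mult.assoc)
  then have "B * ?A = ?A * B" by (simp add: left_diff_distrib right_diff_distrib)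
  with AB show "B * ?A = 1" by simp
qed

text \<open>The candidate \<open>W\<close> simplifies to \<open>\<mu>\<^sup>2 / (\<mu> - 1)\<close>
  times \<open>Y\<^sup>2 V U\<close>. The factorization then turns \<open>?N * W\<close> into
  \<open>?A * ?K * (V * U)\<close>, which collapses from the inside.\<close>

lemma resolvent_of_coefficient:
  fixes T Y :: "'a::complex_normed_vector bop"
  assumes TY: "T * (Y * Y) = Y - 1" and inv: "op_invertible Y" and "\<mu> \<noteq> 0" "\<mu> \<noteq> 1"
    and A: "op_invertible (scalar_op \<mu> - Y)"
    and K: "op_invertible (scalar_op (\<mu> / (\<mu> - 1)) - Y)"
  defines "U \<equiv> op_inverse (scalar_op \<mu> - Y)"
    and "V \<equiv> op_inverse (scalar_op (\<mu> / (\<mu> - 1)) - Y)"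
  defines "W \<equiv> (\<mu> ^ 4 / (\<mu> - 1)) *\<^sub>C (V * (U - (1 / \<mu>\<^sup>2) *\<^sub>C (scalar_op \<mu> + Y)))"
  shows "(scalar_op ((\<mu> - 1) / \<mu>\<^sup>2) - T) * W = 1" "W * (scalar_op ((\<mu> - 1) / \<mu>\<^sup>2) - T) = 1"
proof -
  let ?N = "scalar_op ((\<mu> - 1) / \<mu>\<^sup>2) - T" and ?A = "scalar_op \<mu> - Y"
    and ?K = "scalar_op (\<mu> / (\<mu> - 1)) - Y"
  have U: "?A * U = 1" "U * ?A = 1" using op_inverse_inverse[OF A] by (simp_all add: U_def)
  have V: "?K * V = 1" "V * ?K = 1" using op_inverse_inverse[OF K] by (simp_all add: V_def)
  have TcY: "T * Y = Y * T" using solution_commutes[OF TY inv] .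
  have UY: "U * Y = Y * U" and UT: "U * T = T * U"
    by (rule commute_inverse[OF U], simp add: algebra_simps TcY)+
  have VY: "V * Y = Y * V" and VT: "V * T = T * V"
    by (rule commute_inverse[OF V], simp add: algebra_simps TcY)+
  \<comment> \<open>Multiplying this difference of squares by \<open>U\<close> cancels
    \<open>?A\<close>, which identifies the bracket in \<open>W\<close> as
    \<open>Y\<^sup>2 U / \<mu>\<^sup>2\<close>.\<close>
  have "\<mu>\<^sup>2 *\<^sub>C 1 - ?A * (scalar_op \<mu> + Y) = Y * Y"
    by (simp add: algebra_simps scaleC_diff_right scaleC_scaleC power2_eq_square)
  then have "Y * Y * U = \<mu>\<^sup>2 *\<^sub>C U - ?A * (scalar_op \<mu> + Y) * U"
    by (metis left_diff_distrib mult.left_neutral scaleC_times_left)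
  also have "?A * (scalar_op \<mu> + Y) * U = scalar_op \<mu> + Y"
  proof -
    have "(scalar_op \<mu> + Y) * U = U * (scalar_op \<mu> + Y)" by (simp add: distrib_left distrib_right UY)
    with U(1) show ?thesis by (metis mult.assoc mult.left_neutral)
  qed
  finally have "U - (1 / \<mu>\<^sup>2) *\<^sub>C (scalar_op \<mu> + Y) = (1 / \<mu>\<^sup>2) *\<^sub>C (Y * Y * U)"
    using \<open>\<mu> \<noteq> 0\<close> by (simp add: scaleC_diff_right scaleC_scaleC scaleC_one)
  then have W: "W = (\<mu>\<^sup>2 / (\<mu> - 1)) *\<^sub>C (Y * Y * (V * U))"
  proof -
    have "V * (Y * Y * U) = Y * Y * (V * U)" by (metis VY mult.assoc)
    moreover have "\<mu> ^ 4 / (\<mu> - 1) * (1 / \<mu>\<^sup>2) = \<mu>\<^sup>2 / (\<mu> - 1)"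
      using \<open>\<mu> \<noteq> 0\<close> by (simp add: power2_eq_square power4_eq_xxxx)
    ultimately show ?thesis
      by (simp only: W_def \<open>U - _ = _\<close> scaleC_times_right scaleC_scaleC)
  qed
  \<comment> \<open>Here the point \<open>\<mu> / (\<mu> - 1)\<close> enters: up to the nonzero
    scalar \<open>\<mu> - 1\<close>, the second factor of the factorization is
    \<open>?K\<close>.\<close>
  have K': "scalar_op \<mu> - (\<mu> - 1) *\<^sub>C Y = (\<mu> - 1) *\<^sub>C ?K"
    using \<open>\<mu> \<noteq> 1\<close> by (simp add: scaleC_diff_right scaleC_scaleC)
  have "?N * W = (1 / (\<mu> - 1)) *\<^sub>C (\<mu>\<^sup>2 *\<^sub>C (?N * (Y * Y)) * (V * U))"
    by (simp add: W scaleC_scaleC mult.assoc)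
  also have "\<dots> = (1 / (\<mu> - 1)) *\<^sub>C ((\<mu> - 1) *\<^sub>C (?A * ?K * (V * U)))"
    by (simp only: solution_factorization[OF TY \<open>\<mu> \<noteq> 0\<close>, symmetric] K'
        scaleC_times_left scaleC_times_right)
  also have "?A * ?K * (V * U) = 1"
    using U(1) V(1) by (metis mult.assoc mult.left_neutral)
  finally show NW: "?N * W = 1"
    using \<open>\<mu> \<noteq> 1\<close> by (simp add: scaleC_scaleC scaleC_one)
  \<comment> \<open>\<open>T\<close> commutes with \<open>Y\<close>, hence with the inverses
    \<open>U\<close> and \<open>V\<close>, so \<open>W\<close> commutes with \<open>?N\<close> and
    one product suffices.\<close>
  have "T * (Y * Y * (V * U)) = Y * Y * (V * U) * T"
    by (metis TcY UT VT mult.assoc)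
  then have "W * ?N = ?N * W"
    by (simp add: W left_diff_distrib right_diff_distrib scaleC_diff_right scaleC_scaleC mult.commute)
  with NW show "W * ?N = 1" by simp
qed

theorem theorem4p4:
  fixes T Y :: "'a::complex_banach bop"
  assumes "T * Y\<^sup>2 - Y + 1 = 0"
    and "0 \<in> resolvent_set Y"
  shows "(\<forall>\<mu>::complex. \<mu> \<noteq> 0 \<and> (\<mu> - 1) / \<mu>\<^sup>2 \<in> resolvent_set T \<longrightarrow>
           \<mu> \<in> resolvent_set Y \<and>
           op_inverse (scalar_op \<mu> - Y) =
             scalar_op (1 / \<mu>)
             + (1 / \<mu> ^ 3) *\<^sub>C op_inverse (scalar_op ((\<mu> - 1) / \<mu>\<^sup>2) - T)
             + (1 / \<mu>\<^sup>2) *\<^sub>C Y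
             - ((\<mu> - 1) / \<mu> ^ 4) *\<^sub>C (Y * op_inverse (scalar_op ((\<mu> - 1) / \<mu>\<^sup>2) - T)))
       \<and> (\<forall>\<mu>::complex. \<mu> \<in> resolvent_set Y \<and> \<mu> \<noteq> 0 \<and> \<mu> \<noteq> 1 \<and> \<mu> / (\<mu> - 1) \<in> resolvent_set Y \<longrightarrow>
           (\<mu> - 1) / \<mu>\<^sup>2 \<in> resolvent_set T \<and>
           op_inverse (scalar_op ((\<mu> - 1) / \<mu>\<^sup>2) - T) =
             (\<mu> ^ 4 / (\<mu> - 1)) *\<^sub>C
               (op_inverse (scalar_op (\<mu> / (\<mu> - 1)) - Y)
                * (op_inverse (scalar_op \<mu> - Y) - (1 / \<mu>\<^sup>2) *\<^sub>C (scalar_op \<mu> + Y))))"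
proof -
  have TY: "T * (Y * Y) = Y - 1"
    using assms(1) by (simp add: power2_eq_square algebra_simps eq_neg_iff_add_eq_0)
  have inv: "op_invertible Y"
  proof -
    \<comment> \<open>At the point 0 the resolvent condition inverts \<open>- Y\<close>; the sign is
      then moved onto \<open>Z\<close>.\<close>
    obtain Z where "- Y * Z = 1" "Z * - Y = 1"
      using assms(2) by (auto simp: resolvent_set_def op_invertible_def)
    then show ?thesis unfolding op_invertible_def by (intro exI[of _ "- Z"]) simp
  qed
  have inverse: "op_invertible A \<and> op_inverse A = B" if "A * B = 1" "B * A = 1"
    for A B :: "'a bop"
    using that op_inverse_eqI unfolding op_invertible_def by blast
  show ?thesis
    unfolding resolvent_set_def mem_Collect_eq
    using inverse[OF resolvent_of_solution[OF TY inv]]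
      inverse[OF resolvent_of_coefficient[OF TY inv]]
    by blast
qed

end
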